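(* Let $I,J\subset\mathbb{R}$ be open intervals with $0\in J$, let $h,\alpha,k:I\to\mathbb{R}$ be smooth functions, and let $X:I\times J\to\mathrm{Nil}^3$, $(s,t)\mapsto X(s,t)$, be a smooth parametrization of a surface satisfying $$X_s(s,0)=\sin\alpha(s)\,\mathbf{e}_1+\cos\alpha(s)\,\mathbf{e}_2+k(s)\,\mathbf{e}_3,$$ $$X_t(s,0)=h(s)\bigl(\cos\alpha(s)\,\mathbf{e}_1-\sin\alpha(s)\,\mathbf{e}_2\bigr)+\mathbf{e}_3,$$ $$\nabla_{X_t}X_t=0.$$ If this surface is minimal, then $h(s)=0$ for all $s$.
   Context: $\mathrm{Nil}^3$ denotes $\mathbb{R}^3$ with coordinates $(x,y,z)$ and the Riemannian metric $g=dx^2+dy^2+\left(dz+\frac12(y\,dx-x\,dy)\right)^2$; $\nabla$ is its Levi-Civita connection. The vector fields $\mathbf{e}_1=\frac{\partial}{\partial x}-\frac{y}{2}\frac{\partial}{\partial z}$, $\mathbf{e}_2=\frac{\partial}{\partial y}+\frac{x}{2}\frac{\partial}{\partial z}$, $\mathbf{e}_3=\frac{\partial}{\partial z}$ form a left-invariant orthonormal frame. $X_s,X_t$ are the partial derivatives of $X$; the condition $\nabla_{X_t}X_t=0$ says that the curves $t\mapsto X(s,t)$ are geodesics. In the two displayed initial conditions the frame is evaluated at $X(s,0)$. A surface is minimal if its mean curvature with respect to $g$ vanishes identically. *)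

theory Defs
  imports "HOL-Analysis.Analysis"
begin

text \<open>Smoothness on an open set: all iterated directional derivatives exist and are
  Frechet differentiable on the set. The definition is meant for open \<open>S\<close> only.\<close>

primrec Ck_on :: "nat \<Rightarrow> 'a::euclidean_space set \<Rightarrow> ('a \<Rightarrow> 'b::real_normed_vector) \<Rightarrow> bool" where
  "Ck_on 0 S f \<longleftrightarrow> continuous_on S f"
| "Ck_on (Suc n) S f \<longleftrightarrow>
     f differentiable_on S \<and> (\<forall>v. Ck_on n S (\<lambda>x. frechet_derivative f (at x) v))"

definition smooth_on :: "'a::euclidean_space set \<Rightarrow> ('a \<Rightarrow> 'b::real_normed_vector) \<Rightarrow> bool" where
  "smooth_on S f \<longleftrightarrow> (\<forall>n. Ck_on n S f)"

text \<open>A Riemannian metric on \<open>\<real>\<^sup>n\<close> is given as a function \<open>g\<close> sending a base point and two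
  tangent vectors (in coordinates) to their inner product.\<close>

type_synonym 'n metric = "real ^ 'n \<Rightarrow> real ^ 'n \<Rightarrow> real ^ 'n \<Rightarrow> real"

definition gram :: "'n::finite metric \<Rightarrow> real ^ 'n \<Rightarrow> real ^ 'n ^ 'n" where
  "gram g p = (\<chi> i j. g p (axis i 1) (axis j 1))"

definition d_gram :: "'n::finite metric \<Rightarrow> real ^ 'n \<Rightarrow> 'n \<Rightarrow> 'n \<Rightarrow> 'n \<Rightarrow> real" where
  "d_gram g p l i j = frechet_derivative (\<lambda>q. gram g q $ i $ j) (at p) (axis l 1)"

text \<open>\<open>christoffel g p k i j\<close> is the symbol \<open>\<Gamma>\<close> of the Levi-Civita connection of \<open>g\<close> with
  upper index \<open>k\<close> and lower indices \<open>i\<close>, \<open>j\<close>.\<close>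

definition christoffel :: "'n::finite metric \<Rightarrow> real ^ 'n \<Rightarrow> 'n \<Rightarrow> 'n \<Rightarrow> 'n \<Rightarrow> real" where
  "christoffel g p k i j =
     1 / 2 * (\<Sum>l\<in>UNIV. matrix_inv (gram g p) $ k $ l *
                (d_gram g p i j l + d_gram g p j i l - d_gram g p l i j))"

text \<open>Covariant derivative (for the Levi-Civita connection of \<open>g\<close>) at parameter \<open>t\<close> of the
  vector field \<open>V\<close> along the curve \<open>c\<close>, that is \<open>\<nabla>\<^bsub>c'\<^esub> V\<close>.\<close>

definition cov_deriv ::
    "'n::finite metric \<Rightarrow> (real \<Rightarrow> real ^ 'n) \<Rightarrow> (real \<Rightarrow> real ^ 'n) \<Rightarrow> real \<Rightarrow> real ^ 'n" where
  "cov_deriv g c V t = vector_derivative V (at t) +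
     (\<chi> k. \<Sum>i\<in>UNIV. \<Sum>j\<in>UNIV.
        christoffel g (c t) k i j * vector_derivative c (at t) $ i * V t $ j)"

definition partial_s :: "(real \<Rightarrow> real \<Rightarrow> 'a::real_normed_vector) \<Rightarrow> real \<Rightarrow> real \<Rightarrow> 'a" where
  "partial_s X s t = vector_derivative (\<lambda>r. X r t) (at s)"

definition partial_t :: "(real \<Rightarrow> real \<Rightarrow> 'a::real_normed_vector) \<Rightarrow> real \<Rightarrow> real \<Rightarrow> 'a" where
  "partial_t X s t = vector_derivative (\<lambda>r. X s r) (at t)"

definition regular_surface ::
    "real set \<Rightarrow> real set \<Rightarrow> (real \<Rightarrow> real \<Rightarrow> 'a::real_normed_vector) \<Rightarrow> bool" where
  "regular_surface I J X \<longleftrightarrow> smooth_on (I \<times> J) (\<lambda>(s, t). X s t) \<and>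
     (\<forall>s\<in>I. \<forall>t\<in>J. \<forall>a b. a *\<^sub>R partial_s X s t + b *\<^sub>R partial_t X s t = 0 \<longrightarrow> a = 0 \<and> b = 0)"

text \<open>The covector \<open>cross3 X\<^sub>s X\<^sub>t\<close> annihilates the tangent plane; raising its index with the
  inverse metric gives a vector that is \<open>g\<close>-orthogonal to the surface.\<close>

definition unit_normal :: "3 metric \<Rightarrow> (real \<Rightarrow> real \<Rightarrow> real ^ 3) \<Rightarrow> real \<Rightarrow> real \<Rightarrow> real ^ 3" where
  "unit_normal g X s t =
     (let p = X s t;
          n = matrix_inv (gram g p) *v cross3 (partial_s X s t) (partial_t X s t)
      in (1 / sqrt (g p n n)) *\<^sub>R n)"

text \<open>Half the trace of the second fundamental form, whose coefficients are
  \<open>l = g(\<nabla>\<^bsub>X\<^sub>s\<^esub> X\<^sub>s, N)\<close>, \<open>m = g(\<nabla>\<^bsub>X\<^sub>s\<^esub> X\<^sub>t, N)\<close>,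
  \<open>n = g(\<nabla>\<^bsub>X\<^sub>t\<^esub> X\<^sub>t, N)\<close>.\<close>

definition mean_curvature :: "3 metric \<Rightarrow> (real \<Rightarrow> real \<Rightarrow> real ^ 3) \<Rightarrow> real \<Rightarrow> real \<Rightarrow> real" where
  "mean_curvature g X s t =
     (let p = X s t; Xs = partial_s X s t; Xt = partial_t X s t; N = unit_normal g X s t;
          E = g p Xs Xs; F = g p Xs Xt; G = g p Xt Xt;
          l = g p (cov_deriv g (\<lambda>r. X r t) (\<lambda>r. partial_s X r t) s) N;
          m = g p (cov_deriv g (\<lambda>r. X r t) (\<lambda>r. partial_t X r t) s) N;
          n = g p (cov_deriv g (\<lambda>r. X s r) (\<lambda>r. partial_t X s r) t) N
      in (l * G - 2 * m * F + n * E) / (2 * (E * G - F\<^sup>2)))"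

definition minimal_surface ::
    "3 metric \<Rightarrow> real set \<Rightarrow> real set \<Rightarrow> (real \<Rightarrow> real \<Rightarrow> real ^ 3) \<Rightarrow> bool" where
  "minimal_surface g I J X \<longleftrightarrow> (\<forall>s\<in>I. \<forall>t\<in>J. mean_curvature g X s t = 0)"

text \<open>\<open>Nil\<^sup>3\<close>: coordinates \<open>x\<close>, \<open>y\<close>, \<open>z\<close> are the components 1, 2, 3, and \<open>nil_form\<close> is the
  one-form \<open>dz + (y dx - x dy) / 2\<close>.\<close>

definition nil_form :: "real ^ 3 \<Rightarrow> real ^ 3 \<Rightarrow> real" where
  "nil_form p u = u $ 3 + (p $ 2 * u $ 1 - p $ 1 * u $ 2) / 2"

definition nil_metric :: "3 metric" where
  "nil_metric p u v = u $ 1 * v $ 1 + u $ 2 * v $ 2 + nil_form p u * nil_form p v"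

definition nil_e1 :: "real ^ 3 \<Rightarrow> real ^ 3" where
  "nil_e1 p = vector [1, 0, - (p $ 2 / 2)]"

definition nil_e2 :: "real ^ 3 \<Rightarrow> real ^ 3" where
  "nil_e2 p = vector [0, 1, p $ 1 / 2]"

definition nil_e3 :: "real ^ 3 \<Rightarrow> real ^ 3" where
  "nil_e3 p = vector [0, 0, 1]"

lemma nil_frame_orthonormal:
  "nil_metric p (nil_e1 p) (nil_e1 p) = 1" "nil_metric p (nil_e2 p) (nil_e2 p) = 1"
  "nil_metric p (nil_e3 p) (nil_e3 p) = 1" "nil_metric p (nil_e1 p) (nil_e2 p) = 0"
  "nil_metric p (nil_e1 p) (nil_e3 p) = 0" "nil_metric p (nil_e2 p) (nil_e3 p) = 0"
  by (simp_all add: nil_metric_def nil_form_def nil_e1_def nil_e2_def nil_e3_def)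

end

theory Submission
  imports Defs "HOL-Complex_Analysis.Conformal_Mappings"
begin

text \<open>The argument works with one fixed \<open>s\<close> at a time. In the left-invariant frame the geodesic
equation of \<open>Nil\<^sup>3\<close> has constant coefficients: the initial velocity
\<open>h (cos \<alpha> e\<^sub>1 - sin \<alpha> e\<^sub>2) + e\<^sub>3\<close> keeps its vertical part while its horizontal part rotates with unit
speed (\<open>nil_geodesic_explicit\<close>). Hence \<open>X\<close> is explicit in terms of \<open>X (s, 0)\<close>, \<open>h\<close> and \<open>\<alpha>\<close>, and so
is \<open>X\<^sub>s\<close> (\<open>nil_geodesic_variation\<close>). In a frame turned along with the velocity, \<open>X\<^sub>t = (h, 0, 1)\<close>, and
the coordinates of \<open>X\<^sub>s\<close> combine \<open>1\<close>, \<open>sin t\<close>, \<open>cos t\<close> and, with coefficient \<open>h h'\<close>, the function \<open>t\<close>.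

Since \<open>\<nabla>\<^bsub>X\<^sub>t\<^esub> X\<^sub>t = 0\<close>, minimality reduces to \<open>l G - 2 m F = 0\<close>
(\<open>mean_curvature_zero_frame\<close>). The left-hand side is a polynomial in \<open>t\<close>, \<open>sin t\<close>, \<open>cos t\<close>; it
vanishes on \<open>J\<close>, hence for all real \<open>t\<close> by analytic continuation (\<open>numerator_zero_extends\<close>).

The growth in \<open>t\<close> is then decisive. The coefficient of \<open>t\<^sup>3\<close> is \<open>h\<^sup>2 (h h')\<^sup>3\<close>, so \<open>h h' = 0\<close>
(\<open>secular_term_zero\<close>). If \<open>h \<noteq> 0\<close>, then \<open>h' = 0\<close>, the remaining linear term in \<open>t\<close> forces
\<open>h'' = 0\<close>, and a trigonometric polynomial of degree three is left. Its
third harmonic is \<open>(1 + h\<^sup>2) h\<^sup>3\<close> times a nonzero amplitude, so it can vanish only if \<open>h = 0\<close>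
(\<open>numerator_zero_imp_horizontal_zero\<close>).\<close>

section \<open>Smooth functions and surfaces\<close>

lemma smooth_on_imp_differentiable:
  assumes "smooth_on S f" and "open S" and "x \<in> S"
  shows "f differentiable (at x)"
proof -
  have "Ck_on (Suc 0) S f"
    using assms(1) unfolding smooth_on_def by blast
  then have "f differentiable (at x within S)"
    using assms(3) by (simp add: differentiable_on_def)
  then show ?thesis
    unfolding at_within_open[OF assms(3,2)] .
qed

lemma smooth_on_frechet_derivative:
  assumes "smooth_on S f"
  shows "smooth_on S (\<lambda>x. frechet_derivative f (at x) v)"
  unfolding smooth_on_def
proof
  fix n
  have "Ck_on (Suc n) S f"
    using assms unfolding smooth_on_def by blast
  then show "Ck_on n S (\<lambda>x. frechet_derivative f (at x) v)"
    by simp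
qed

lemma smooth_on_has_vector_derivative:
  fixes f :: "'a :: euclidean_space \<Rightarrow> 'b :: real_normed_vector"
  assumes f: "smooth_on S f" "open S" "l t \<in> S"
    and l: "(l has_derivative (\<lambda>r. r *\<^sub>R v)) (at t)"
  shows "((\<lambda>r. f (l r)) has_vector_derivative frechet_derivative f (at (l t)) v) (at t)"
proof -
  have D: "(f has_derivative frechet_derivative f (at (l t))) (at (l t))"
    using smooth_on_imp_differentiable[OF f] by (simp add: frechet_derivative_works[symmetric])
  have "((\<lambda>r. f (l r)) has_derivative (\<lambda>r. frechet_derivative f (at (l t)) (r *\<^sub>R v))) (at t)"
    by (rule has_derivative_compose[OF l D])
  then show ?thesis
    unfolding has_vector_derivative_def linear_scale[OF has_derivative_linear[OF D]] .
qed

lemma smooth_on_real_derivative: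
  fixes f :: "real \<Rightarrow> real"
  assumes "smooth_on I f" "open I"
  obtains f' where "smooth_on I f'" "\<And>s. s \<in> I \<Longrightarrow> (f has_real_derivative f' s) (at s)"
proof
  show "smooth_on I (\<lambda>s. frechet_derivative f (at s) 1)"
    by (rule smooth_on_frechet_derivative[OF assms(1)])
  show "(f has_real_derivative frechet_derivative f (at s) 1) (at s)" if "s \<in> I" for s
    unfolding has_real_derivative_iff_has_vector_derivative
    by (rule smooth_on_has_vector_derivative[where l = "\<lambda>r. r", OF assms that])
      (simp add: has_derivative_ident)
qed

lemma smooth_surface_derivatives:
  fixes X :: "real \<Rightarrow> real \<Rightarrow> 'a :: real_normed_vector"
  assumes X: "smooth_on (I \<times> J) (\<lambda>(s, t). X s t)" and IJ: "open I" "open J" "s \<in> I" "t \<in> J"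
  shows "((\<lambda>r. X r t) has_vector_derivative partial_s X s t) (at s)"
    and "(X s has_vector_derivative partial_t X s t) (at t)"
    and "\<exists>w. (partial_t X s has_vector_derivative w) (at t)"
proof -
  let ?f = "\<lambda>(s, t). X s t"
  have o: "open (I \<times> J)"
    using IJ by (simp add: open_Times)
  have s_line: "((\<lambda>r. f (r, t)) has_vector_derivative frechet_derivative f (at (s, t)) (1, 0)) (at s)"
    and t_line: "((\<lambda>r. f (s, r)) has_vector_derivative frechet_derivative f (at (s, t)) (0, 1)) (at t)"
    if "smooth_on (I \<times> J) f" "t \<in> J" for f :: "real \<times> real \<Rightarrow> 'a" and t
  proof -
    have mem: "(s, t) \<in> I \<times> J"
      using IJ(3) that(2) by simp
    have "((\<lambda>r. (r, t)) has_derivative (\<lambda>r. r *\<^sub>R (1, 0))) (at s)"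
      by (simp add: has_derivative_Pair has_derivative_ident has_derivative_const)
    then show "((\<lambda>r. f (r, t)) has_vector_derivative frechet_derivative f (at (s, t)) (1, 0)) (at s)"
      by (rule smooth_on_has_vector_derivative[where l = "\<lambda>r. (r, t)", OF that(1) o mem])
    have "((\<lambda>r. (s, r)) has_derivative (\<lambda>r. r *\<^sub>R (0, 1))) (at t)"
      by (simp add: has_derivative_Pair has_derivative_ident has_derivative_const)
    then show "((\<lambda>r. f (s, r)) has_vector_derivative frechet_derivative f (at (s, t)) (0, 1)) (at t)"
      by (rule smooth_on_has_vector_derivative[where l = "\<lambda>r. (s, r)", OF that(1) o mem])
  qed
  show "((\<lambda>r. X r t) has_vector_derivative partial_s X s t) (at s)"
    using s_line[OF X IJ(4)] vector_derivative_at[OF s_line[OF X IJ(4)]]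
    by (simp add: partial_s_def)
  have t: "(X s has_vector_derivative frechet_derivative ?f (at (s, t)) (0, 1)) (at t)" if "t \<in> J" for t
    using t_line[OF X that] by simp
  have pt: "partial_t X s t = frechet_derivative ?f (at (s, t)) (0, 1)" if "t \<in> J" for t
    unfolding partial_t_def using vector_derivative_at[OF t[OF that]] .
  show "(X s has_vector_derivative partial_t X s t) (at t)"
    using t[OF IJ(4)] pt[OF IJ(4)] by simp
  from t_line[OF smooth_on_frechet_derivative[OF X, of "(0, 1)"] IJ(4)]
  have "(partial_t X s has_vector_derivative
      frechet_derivative (\<lambda>x. frechet_derivative ?f (at x) (0, 1)) (at (s, t)) (0, 1)) (at t)"
    by (rule has_vector_derivative_transform_within_open[OF _ IJ(2,4)]) (rule pt[symmetric])
  then show "\<exists>w. (partial_t X s has_vector_derivative w) (at t)" ..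
qed

section \<open>Vectors in three dimensions\<close>

lemma has_vector_derivative_vec_iff:
  fixes f :: "real \<Rightarrow> real ^ 'n"
  shows "(f has_vector_derivative f') (at t) \<longleftrightarrow>
    (\<forall>i. ((\<lambda>r. f r $ i) has_real_derivative f' $ i) (at t))"
  unfolding has_vector_derivative_def has_derivative_componentwise_within[of f]
  by (auto simp: Basis_vec_def inner_axis has_field_derivative_def mult_commute_abs)

lemma vec3_eq_iff: "(u :: 'a ^ 3) = v \<longleftrightarrow> u $ 1 = v $ 1 \<and> u $ 2 = v $ 2 \<and> u $ 3 = v $ 3"
  by (simp add: vec_eq_iff forall_3)

lemma inner_vec3: "(a :: real ^ 3) \<bullet> b = a $ 1 * b $ 1 + a $ 2 * b $ 2 + a $ 3 * b $ 3"
  by (simp add: inner_vec_def sum_3)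

lemma cross3_nth:
  "cross3 a b $ 1 = a $ 2 * b $ 3 - a $ 3 * b $ 2"
  "cross3 a b $ 2 = a $ 3 * b $ 1 - a $ 1 * b $ 3"
  "cross3 a b $ 3 = a $ 1 * b $ 2 - a $ 2 * b $ 1"
  by (simp_all add: cross3_def)

lemma cos_sin_sq: "cos x * cos x + sin x * sin x = (1 :: real)"
  by (metis add.commute power2_eq_square sin_cos_squared_add)

section \<open>The Levi-Civita connection in the left-invariant frame\<close>

definition of_frame :: "real ^ 3 \<Rightarrow> real ^ 3 \<Rightarrow> real ^ 3" where
  "of_frame p a = a $ 1 *\<^sub>R nil_e1 p + a $ 2 *\<^sub>R nil_e2 p + a $ 3 *\<^sub>R nil_e3 p"

definition frame_coords :: "real ^ 3 \<Rightarrow> real ^ 3 \<Rightarrow> real ^ 3" where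
  "frame_coords p v = vector [v $ 1, v $ 2, nil_form p v]"

lemma of_frame_nth [simp]:
  "of_frame p a $ 1 = a $ 1"
  "of_frame p a $ 2 = a $ 2"
  "of_frame p a $ 3 = a $ 3 - p $ 2 * a $ 1 / 2 + p $ 1 * a $ 2 / 2"
  by (simp_all add: of_frame_def nil_e1_def nil_e2_def nil_e3_def mult.commute)

lemma of_frame_coords: "of_frame p (frame_coords p v) = v"
  by (simp add: vec3_eq_iff frame_coords_def nil_form_def field_simps)

lemma of_frame_eq_iff [simp]: "of_frame p a = of_frame p b \<longleftrightarrow> a = b"
  by (auto simp: vec3_eq_iff)

lemma of_frame_zero_iff [simp]: "of_frame p a = 0 \<longleftrightarrow> a = 0"
  by (auto simp: vec3_eq_iff)

lemma of_frame_linear: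
  "of_frame p (a + b) = of_frame p a + of_frame p b"
  "of_frame p (c *\<^sub>R a) = c *\<^sub>R of_frame p a"
  by (auto simp: vec3_eq_iff field_simps)

lemma nil_metric_of_frame: "nil_metric p (of_frame p a) (of_frame p b) = a \<bullet> b"
  by (simp add: nil_metric_def nil_form_def inner_vec3 field_simps)

lemma gram_nil:
  "gram nil_metric p = vector [
     vector [1 + (p $ 2)\<^sup>2 / 4, - (p $ 1 * p $ 2 / 4), p $ 2 / 2],
     vector [- (p $ 1 * p $ 2 / 4), 1 + (p $ 1)\<^sup>2 / 4, - (p $ 1 / 2)],
     vector [p $ 2 / 2, - (p $ 1 / 2), 1]]"
  by (simp add: vec_eq_iff forall_3 gram_def nil_metric_def nil_form_def axis_def power2_eq_square)

text \<open>The inverse matrix is chosen by Hilbert's operator, so a two-sided inverse has to be compared with it.\<close>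
lemma matrix_inv_eqI:
  assumes "A ** B = mat 1" and "B ** A = mat 1"
  shows "matrix_inv A = B"
proof -
  have inv: "A ** matrix_inv A = mat 1 \<and> matrix_inv A ** A = mat 1"
    unfolding matrix_inv_def by (rule someI[of _ B]) (use assms in auto)
  have "matrix_inv A = matrix_inv A ** (A ** B)"
    by (simp add: assms)
  also have "\<dots> = B"
    using inv by (simp add: matrix_mul_assoc)
  finally show ?thesis .
qed

text \<open>The inverse Gram matrix of an orthonormal frame is the sum of the squares of the frame vectors.\<close>
lemma matrix_inv_gram_nil:
  "matrix_inv (gram nil_metric p) = vector [
     vector [1, 0, - (p $ 2 / 2)],
     vector [0, 1, p $ 1 / 2],
     vector [- (p $ 2 / 2), p $ 1 / 2, 1 + ((p $ 1)\<^sup>2 + (p $ 2)\<^sup>2) / 4]]"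
  by (rule matrix_inv_eqI)
    (simp_all add: gram_nil vec_eq_iff forall_3 matrix_matrix_mult_def sum_3 mat_def
       power2_eq_square field_simps)

lemma d_gram_eqI:
  assumes "((\<lambda>q. gram g q $ i $ j) has_derivative D) (at p)"
  shows "d_gram g p l i j = D (axis l 1)"
  using frechet_derivative_at[OF assms] by (simp add: d_gram_def)

lemma has_derivative_vec_nth [derivative_intros]:
  "((\<lambda>q :: real ^ 'n. q $ i) has_derivative (\<lambda>v. v $ i)) (at p)"
  by (rule bounded_linear_imp_has_derivative) (rule bounded_linear_vec_nth)

lemma d_gram_nil:
  "d_gram nil_metric p l 1 1 = p $ 2 * axis l 1 $ 2 / 2"
  "d_gram nil_metric p l 2 2 = p $ 1 * axis l 1 $ 1 / 2"
  "d_gram nil_metric p l 3 3 = 0"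
  "d_gram nil_metric p l 1 2 = - ((axis l 1 $ 1 * p $ 2 + p $ 1 * axis l 1 $ 2) / 4)"
  "d_gram nil_metric p l 2 1 = - ((axis l 1 $ 1 * p $ 2 + p $ 1 * axis l 1 $ 2) / 4)"
  "d_gram nil_metric p l 1 3 = axis l 1 $ 2 / 2"
  "d_gram nil_metric p l 3 1 = axis l 1 $ 2 / 2"
  "d_gram nil_metric p l 2 3 = - (axis l 1 $ 1 / 2)"
  "d_gram nil_metric p l 3 2 = - (axis l 1 $ 1 / 2)"
  by (rule trans[OF d_gram_eqI], simp only: gram_nil vector_3,
      (auto intro!: derivative_eq_intros simp: power2_eq_square; fail)[1],
      simp add: field_simps)+

text \<open>The bilinear map \<open>(a, v) \<mapsto> \<nabla>\<^bsub>a\<^esub> v\<close> for left-invariant fields with constant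
frame coordinates. By Koszul's formula it is determined by the only nonzero bracket of the frame,
\<open>[e\<^sub>1, e\<^sub>2] = e\<^sub>3\<close>.\<close>
definition connection :: "real ^ 3 \<Rightarrow> real ^ 3 \<Rightarrow> real ^ 3" where
  "connection a v = vector [(a $ 2 * v $ 3 + a $ 3 * v $ 2) / 2,
     - ((a $ 1 * v $ 3 + a $ 3 * v $ 1) / 2), (a $ 1 * v $ 2 - a $ 2 * v $ 1) / 2]"

lemma connection_nth [simp]:
  "connection a v $ 1 = (a $ 2 * v $ 3 + a $ 3 * v $ 2) / 2"
  "connection a v $ 2 = - ((a $ 1 * v $ 3 + a $ 3 * v $ 1) / 2)"
  "connection a v $ 3 = (a $ 1 * v $ 2 - a $ 2 * v $ 1) / 2"
  by (simp_all add: connection_def)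

text \<open>The Christoffel term expressed in the frame. The correction in the last coordinate is the
derivative of the frame itself along \<open>a\<close>; it cancels when a vector field
is differentiated through its frame coordinates, as in the lemma after this one.\<close>
lemma christoffel_nil_sum:
  fixes p a v :: "real ^ 3"
  shows "(\<chi> k. \<Sum>i\<in>UNIV. \<Sum>j\<in>UNIV.
      christoffel nil_metric p k i j * of_frame p a $ i * of_frame p v $ j) =
    of_frame p (connection a v) - vector [0, 0, (a $ 1 * v $ 2 - a $ 2 * v $ 1) / 2]"
  by (simp add: vec3_eq_iff christoffel_def sum_3 matrix_inv_gram_nil d_gram_nil axis_def)
    (simp add: field_simps power2_eq_square)

lemma cov_deriv_of_frame:
  assumes c: "(c has_vector_derivative of_frame (c t) a) (at t)"
    and v: "(v has_vector_derivative v') (at t)"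
    and S: "open S" "t \<in> S"
    and V: "\<And>r. r \<in> S \<Longrightarrow> V r = of_frame (c r) (v r)"
  shows "cov_deriv nil_metric c V t = of_frame (c t) (v' + connection a (v t))"
proof -
  have c': "((\<lambda>r. c r $ i) has_real_derivative of_frame (c t) a $ i) (at t)"
    and v'[derivative_intros]: "((\<lambda>r. v r $ i) has_real_derivative v' $ i) (at t)" for i
    using c v by (simp_all add: has_vector_derivative_vec_iff)
  have cd[derivative_intros]: "((\<lambda>r. c r $ 1) has_real_derivative a $ 1) (at t)"
     "((\<lambda>r. c r $ 2) has_real_derivative a $ 2) (at t)"
    using c'[of 1] c'[of 2] by simp_all
  have "((\<lambda>r. of_frame (c r) (v r)) has_vector_derivative
      of_frame (c t) v' + vector [0, 0, (a $ 1 * v t $ 2 - a $ 2 * v t $ 1) / 2]) (at t)"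
    unfolding has_vector_derivative_vec_iff forall_3
    by (auto intro!: derivative_eq_intros simp: field_simps)
  then have "(V has_vector_derivative
      of_frame (c t) v' + vector [0, 0, (a $ 1 * v t $ 2 - a $ 2 * v t $ 1) / 2]) (at t)"
    by (rule has_vector_derivative_transform_within_open[OF _ S]) (simp add: V)
  then have "vector_derivative V (at t) =
      of_frame (c t) v' + vector [0, 0, (a $ 1 * v t $ 2 - a $ 2 * v t $ 1) / 2]"
    by (rule vector_derivative_at)
  then show ?thesis
    by (simp add: cov_deriv_def vector_derivative_at[OF c] V[OF S(2)] christoffel_nil_sum
        of_frame_linear)
qed

section \<open>Geodesics transversal to the horizontal planes\<close>

text \<open>The helix through \<open>p\<close> whose velocity at \<open>p\<close> is
\<open>h (cos \<alpha> e\<^sub>1 - sin \<alpha> e\<^sub>2) + e\<^sub>3\<close>. The part of the last coordinate that is linear in \<open>p\<close> comes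
from the group law: this is the left translate by \<open>p\<close> of the helix through the origin.\<close>
definition nil_geodesic :: "real ^ 3 \<Rightarrow> real \<Rightarrow> real \<Rightarrow> real \<Rightarrow> real ^ 3" where
  "nil_geodesic p h \<alpha> t = p + vector [h * (sin (t - \<alpha>) + sin \<alpha>), h * (cos \<alpha> - cos (t - \<alpha>)),
     t - (p $ 2 * (h * (sin (t - \<alpha>) + sin \<alpha>)) - p $ 1 * (h * (cos \<alpha> - cos (t - \<alpha>)))) / 2
       - h\<^sup>2 * (sin t - t) / 2]"

lemma frame_coords_has_vector_derivative:
  assumes "(c has_vector_derivative c') (at t)" "(v has_vector_derivative v') (at t)"
  shows "\<exists>w. ((\<lambda>r. frame_coords (c r) (v r)) has_vector_derivative w) (at t)"
proof -
  have [derivative_intros]: "((\<lambda>r. c r $ i) has_real_derivative c' $ i) (at t)"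
    "((\<lambda>r. v r $ i) has_real_derivative v' $ i) (at t)" for i
    using assms by (simp_all add: has_vector_derivative_vec_iff)
  have "((\<lambda>r. frame_coords (c r) (v r)) has_vector_derivative vector [v' $ 1, v' $ 2, v' $ 3 +
     (c' $ 2 * v t $ 1 + c t $ 2 * v' $ 1 - (c' $ 1 * v t $ 2 + c t $ 1 * v' $ 2)) / 2]) (at t)"
    unfolding has_vector_derivative_vec_iff forall_3 frame_coords_def nil_form_def vector_3
    by (auto intro!: derivative_eq_intros simp: field_simps)
  then show ?thesis ..
qed

text \<open>In the frame the geodesic equation reads \<open>u\<^sub>1' = - u\<^sub>2 u\<^sub>3\<close>, \<open>u\<^sub>2' = u\<^sub>1 u\<^sub>3\<close>,
\<open>u\<^sub>3' = 0\<close>. So with \<open>u\<^sub>3 = 1\<close> the horizontal part of the velocity rotates with unit speed,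
and the coordinates of the geodesic follow by integration.\<close>
lemma nil_geodesic_explicit:
  assumes "is_interval J" "0 \<in> J"
    and c: "\<And>t. t \<in> J \<Longrightarrow> (c has_vector_derivative of_frame (c t) (u t)) (at t)"
    and u: "\<And>t. t \<in> J \<Longrightarrow> (u has_vector_derivative u' t) (at t)"
    and geo: "\<And>t. t \<in> J \<Longrightarrow> u' t + connection (u t) (u t) = 0"
    and u0: "u 0 = vector [h * cos \<alpha>, - (h * sin \<alpha>), 1]"
    and t: "t \<in> J"
  shows "u t = vector [h * cos (t - \<alpha>), h * sin (t - \<alpha>), 1]"
    and "c t = nil_geodesic (c 0) h \<alpha> t"
proof -
  have const: "f t = f 0" if "\<And>r. r \<in> J \<Longrightarrow> (f has_real_derivative 0) (at r)" "t \<in> J"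
    for f :: "real \<Rightarrow> real" and t
    using has_field_derivative_zero_constant[of J f] that assms(1,2)
    by (metis has_field_derivative_at_within is_interval_convex)
  have ud[derivative_intros]: "((\<lambda>r. u r $ 1) has_real_derivative - (u t $ 2 * u t $ 3)) (at t)"
     "((\<lambda>r. u r $ 2) has_real_derivative u t $ 1 * u t $ 3) (at t)"
     "((\<lambda>r. u r $ 3) has_real_derivative 0) (at t)" if "t \<in> J" for t
    using u[OF that] geo[OF that]
    by (auto simp: has_vector_derivative_vec_iff forall_3 vec3_eq_iff add_eq_0_iff2 algebra_simps)
  have u3: "u t $ 3 = 1" if "t \<in> J" for t
    using const[of "\<lambda>r. u r $ 3", OF ud(3) that] u0 by simp
  \<comment> \<open>Two first integrals: the horizontal velocity, rotated back by the angle \<open>t\<close>.\<close>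
  have A: "u t $ 1 * cos t + u t $ 2 * sin t = h * cos \<alpha>" if "t \<in> J" for t
    by (rule trans[OF const[of "\<lambda>t. u t $ 1 * cos t + u t $ 2 * sin t", OF _ that]])
      (auto intro!: derivative_eq_intros simp: u0 u3)
  have B: "u t $ 2 * cos t - u t $ 1 * sin t = - (h * sin \<alpha>)" if "t \<in> J" for t
    by (rule trans[OF const[of "\<lambda>t. u t $ 2 * cos t - u t $ 1 * sin t", OF _ that]])
      (auto intro!: derivative_eq_intros simp: u0 u3)
  have u12: "u t $ 1 = h * cos (t - \<alpha>)" "u t $ 2 = h * sin (t - \<alpha>)" if "t \<in> J" for t
    using A[OF that] B[OF that] cos_sin_sq[of t] unfolding cos_diff sin_diff by algebra+
  show "u t = vector [h * cos (t - \<alpha>), h * sin (t - \<alpha>), 1]"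
    using t by (simp add: vec3_eq_iff u12 u3)
  have cd: "((\<lambda>r. c r $ 1) has_real_derivative h * cos (t - \<alpha>)) (at t)"
     "((\<lambda>r. c r $ 2) has_real_derivative h * sin (t - \<alpha>)) (at t)"
     "((\<lambda>r. c r $ 3) has_real_derivative 1 - c t $ 2 * (h * cos (t - \<alpha>)) / 2
         + c t $ 1 * (h * sin (t - \<alpha>)) / 2) (at t)" if "t \<in> J" for t
    using c[OF that] that by (simp_all add: has_vector_derivative_vec_iff forall_3 u12 u3)
  have c1: "c t $ 1 = c 0 $ 1 + h * (sin (t - \<alpha>) + sin \<alpha>)" if "t \<in> J" for t
  proof -
    have "c t $ 1 - h * sin (t - \<alpha>) = c 0 $ 1 - h * sin (0 - \<alpha>)"
      by (rule const[OF _ that]) (auto intro!: derivative_eq_intros cd)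
    then show ?thesis
      by (simp add: algebra_simps)
  qed
  have c2: "c t $ 2 = c 0 $ 2 + h * (cos \<alpha> - cos (t - \<alpha>))" if "t \<in> J" for t
  proof -
    have "c t $ 2 + h * cos (t - \<alpha>) = c 0 $ 2 + h * cos (0 - \<alpha>)"
      by (rule const[OF _ that]) (auto intro!: derivative_eq_intros cd)
    then show ?thesis
      by (simp add: algebra_simps)
  qed
  have cst: "cos t = cos \<alpha> * cos (t - \<alpha>) - sin \<alpha> * sin (t - \<alpha>)" for t
    using cos_add[of \<alpha> "t - \<alpha>"] by simp
  define z where "z t = t - (c 0 $ 2 * (h * (sin (t - \<alpha>) + sin \<alpha>))
      - c 0 $ 1 * (h * (cos \<alpha> - cos (t - \<alpha>)))) / 2 - h\<^sup>2 * (sin t - t) / 2" for t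
  have "(z has_real_derivative 1 - c t $ 2 * (h * cos (t - \<alpha>)) / 2
         + c t $ 1 * (h * sin (t - \<alpha>)) / 2) (at t)" if "t \<in> J" for t
  proof -
    have "(z has_real_derivative 1 - (c 0 $ 2 * (h * cos (t - \<alpha>)) - c 0 $ 1 * (h * sin (t - \<alpha>))) / 2
        - h\<^sup>2 * (cos t - 1) / 2) (at t)"
      unfolding z_def by (rule derivative_eq_intros refl | simp add: field_simps; fail)+
    then show ?thesis
    proof (rule DERIV_cong)
      have "h\<^sup>2 * (cos t - 1) = h * (cos \<alpha> - cos (t - \<alpha>)) * (h * cos (t - \<alpha>))
        - h * (sin (t - \<alpha>) + sin \<alpha>) * (h * sin (t - \<alpha>))"
      unfolding cst[of t] using cos_sin_sq[of "t - \<alpha>"] by algebra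
      then show "1 - (c 0 $ 2 * (h * cos (t - \<alpha>)) - c 0 $ 1 * (h * sin (t - \<alpha>))) / 2
          - h\<^sup>2 * (cos t - 1) / 2
        = 1 - c t $ 2 * (h * cos (t - \<alpha>)) / 2 + c t $ 1 * (h * sin (t - \<alpha>)) / 2"
        unfolding c1[OF that] c2[OF that] by (simp only:) (simp add: algebra_simps add_divide_distrib diff_divide_distrib)
    qed
  qed
  then have "c t $ 3 - z t = c 0 $ 3 - z 0"
    by (intro const[OF _ t]) (auto intro!: derivative_eq_intros cd)
  then show "c t = nil_geodesic (c 0) h \<alpha> t"
    using c1[OF t] c2[OF t] by (simp add: vec3_eq_iff z_def nil_geodesic_def)
qed

section \<open>Rotation about the vertical axis\<close>

text \<open>A turn of the horizontal plane about \<open>e\<^sub>3\<close>. Rotations about the z-axis are isometries that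
preserve orientation, so the inner product, the cross product and the connection commute with it.
Turning the frame along with the geodesic makes the velocity \<open>(h, 0, 1)\<close> constant.\<close>
definition rot :: "real \<Rightarrow> real ^ 3 \<Rightarrow> real ^ 3" where
  "rot \<theta> b = vector [cos \<theta> * b $ 1 - sin \<theta> * b $ 2, sin \<theta> * b $ 1 + cos \<theta> * b $ 2, b $ 3]"

lemma rot_nth [simp]:
  "rot \<theta> b $ 1 = cos \<theta> * b $ 1 - sin \<theta> * b $ 2"
  "rot \<theta> b $ 2 = sin \<theta> * b $ 1 + cos \<theta> * b $ 2"
  "rot \<theta> b $ 3 = b $ 3"
  by (simp_all add: rot_def)

lemma rot_inner: "rot \<theta> a \<bullet> rot \<theta> b = a \<bullet> b"
  unfolding inner_vec3 rot_nth using cos_sin_sq[of \<theta>] by algebra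

lemma rot_cross3: "cross3 (rot \<theta> a) (rot \<theta> b) = rot \<theta> (cross3 a b)"
proof -
  have "rot \<theta> a $ 1 * rot \<theta> b $ 2 - rot \<theta> a $ 2 * rot \<theta> b $ 1 = a $ 1 * b $ 2 - a $ 2 * b $ 1"
    unfolding rot_nth using cos_sin_sq[of \<theta>] by algebra
  then show ?thesis
    by (simp add: vec3_eq_iff cross3_nth) (simp add: algebra_simps)
qed

lemma rot_connection: "connection (rot \<theta> a) (rot \<theta> b) = rot \<theta> (connection a b)"
proof -
  have "rot \<theta> a $ 1 * rot \<theta> b $ 2 - rot \<theta> a $ 2 * rot \<theta> b $ 1 = a $ 1 * b $ 2 - a $ 2 * b $ 1"
    unfolding rot_nth using cos_sin_sq[of \<theta>] by algebra
  then show ?thesis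
    by (simp add: vec3_eq_iff) (simp add: field_simps)
qed

lemma rot_add: "rot \<theta> (a + b) = rot \<theta> a + rot \<theta> b"
  by (simp add: vec3_eq_iff algebra_simps)

lemma has_vector_derivative_rot:
  assumes "(b has_vector_derivative b') (at s)" and "(\<theta> has_real_derivative \<theta>') (at s)"
  shows "((\<lambda>r. rot (\<theta> r) (b r)) has_vector_derivative
    rot (\<theta> s) (b' + \<theta>' *\<^sub>R vector [- (b s $ 2), b s $ 1, 0])) (at s)"
proof -
  have [derivative_intros]: "((\<lambda>r. b r $ i) has_real_derivative b' $ i) (at s)" for i
    using assms(1) by (simp add: has_vector_derivative_vec_iff)
  show ?thesis
    unfolding has_vector_derivative_vec_iff forall_3
    by (auto intro!: derivative_eq_intros assms(2) simp: algebra_simps)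
qed

section \<open>The variation field of a family of geodesics\<close>

text \<open>Coordinates, in the frame turned by the angle \<open>t - \<alpha>\<close>, of the Jacobi field \<open>X\<^sub>s\<close> along the
geodesic. Here \<open>h1\<close> and \<open>\<alpha>1\<close> stand for the derivatives of \<open>h\<close> and \<open>\<alpha>\<close>. The last coordinate encodes
\<open>g(X\<^sub>s, X\<^sub>t) = k + h h1 t\<close>, which is affine in \<open>t\<close> as for every geodesic variation.\<close>
definition variation_coords :: "real \<Rightarrow> real \<Rightarrow> real \<Rightarrow> real \<Rightarrow> real \<Rightarrow> real ^ 3" where
  "variation_coords h h1 \<alpha>1 k t =
     (let b1 = (1 + h1) * sin t - h * \<alpha>1 * (1 - cos t)
      in vector [b1, (1 + h1) * cos t - h1 - h * \<alpha>1 * sin t, k + h * h1 * t - h * b1])"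

text \<open>Since the geodesics are explicit, \<open>X\<^sub>s\<close> is found by differentiating their formula in \<open>s\<close>. Its first
two frame coordinates are the horizontal velocities of base point and displacement, and the third
one differs from \<open>k\<close> by area terms of the group law.\<close>
lemma nil_geodesic_variation:
  fixes x0 :: "real \<Rightarrow> real ^ 3"
  assumes x0: "(x0 has_vector_derivative of_frame (x0 s) (vector [sin (\<alpha> s), cos (\<alpha> s), k])) (at s)"
    and h[derivative_intros]: "(h has_real_derivative h1) (at s)"
    and \<alpha>[derivative_intros]: "(\<alpha> has_real_derivative \<alpha>1) (at s)"
  shows "((\<lambda>r. nil_geodesic (x0 r) (h r) (\<alpha> r) t) has_vector_derivative
    of_frame (nil_geodesic (x0 s) (h s) (\<alpha> s) t)
      (rot (t - \<alpha> s) (variation_coords (h s) h1 \<alpha>1 k t))) (at s)"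
proof -
  define c where "c r t = nil_geodesic (x0 r) (h r) (\<alpha> r) t" for r t
  define b1 b2 where "b1 t = (1 + h1) * sin t - h s * \<alpha>1 * (1 - cos t)"
    and "b2 t = (1 + h1) * cos t - h1 - h s * \<alpha>1 * sin t" for t
  define \<sigma> \<gamma> A B where "\<sigma> = sin (t - \<alpha> s)" and "\<gamma> = cos (t - \<alpha> s)" and "A = sin (\<alpha> s)" and "B = cos (\<alpha> s)"
  have S: "sin t = \<sigma> * B + \<gamma> * A" and C: "cos t = \<gamma> * B - \<sigma> * A"
    using sin_add[of "t - \<alpha> s" "\<alpha> s"] cos_add[of "t - \<alpha> s" "\<alpha> s"] by (simp_all add: \<sigma>_def \<gamma>_def A_def B_def)
  have one: "\<gamma> * \<gamma> + \<sigma> * \<sigma> = 1" "B * B + A * A = 1"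
    by (simp_all add: \<sigma>_def \<gamma>_def A_def B_def cos_sin_sq)
  have x0d [derivative_intros]: "((\<lambda>r. x0 r $ 1) has_real_derivative A) (at s)"
    "((\<lambda>r. x0 r $ 2) has_real_derivative B) (at s)"
    "((\<lambda>r. x0 r $ 3) has_real_derivative k - x0 s $ 2 * A / 2 + x0 s $ 1 * B / 2) (at s)"
    using x0 by (simp_all add: has_vector_derivative_vec_iff forall_3 A_def B_def)
  \<comment> \<open>\<open>P\<close> and \<open>Q\<close> are the horizontal displacements along the geodesic, primes are derivatives in \<open>s\<close>.\<close>
  define P Q where "P = h s * (\<sigma> + A)" and "Q = h s * (B - \<gamma>)"
  define P' Q' where "P' = h1 * (\<sigma> + A) + h s * \<alpha>1 * (B - \<gamma>)" and "Q' = h1 * (B - \<gamma>) - h s * \<alpha>1 * (\<sigma> + A)"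
  have a1: "\<gamma> * b1 t - \<sigma> * b2 t = A + P'"
    unfolding b1_def b2_def S C P'_def using one by algebra
  have a2: "\<sigma> * b1 t + \<gamma> * b2 t = B + Q'"
    unfolding b1_def b2_def S C Q'_def using one by algebra
  have a3: "k + h s * h1 * t - h s * b1 t = k + Q * A - P * B + (Q * P' - P * Q') / 2 - h s * h1 * (sin t - t)"
  proof -
    have "2 * (h s * b1 t) = 2 * (h s * h1 * sin t) - (2 * (Q * A - P * B) + (Q * P' - P * Q'))"
      unfolding b1_def S C P'_def Q'_def P_def Q_def using one by algebra
    then show ?thesis
      by (simp add: field_simps)
  qed
  have Pd [derivative_intros]: "((\<lambda>r. h r * (sin (t - \<alpha> r) + sin (\<alpha> r))) has_real_derivative P') (at s)"
    by (auto intro!: derivative_eq_intros simp: P'_def \<sigma>_def \<gamma>_def A_def B_def algebra_simps)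
  have Qd [derivative_intros]: "((\<lambda>r. h r * (cos (\<alpha> r) - cos (t - \<alpha> r))) has_real_derivative Q') (at s)"
    by (auto intro!: derivative_eq_intros simp: Q'_def \<sigma>_def \<gamma>_def A_def B_def algebra_simps)
  have c1: "((\<lambda>r. c r t $ 1) has_real_derivative A + P') (at s)"
    unfolding c_def nil_geodesic_def by (simp, intro DERIV_add x0d Pd)
  have c2: "((\<lambda>r. c r t $ 2) has_real_derivative B + Q') (at s)"
    unfolding c_def nil_geodesic_def by (simp, intro DERIV_add x0d Qd)
  have cs: "c s t $ 1 = x0 s $ 1 + P" "c s t $ 2 = x0 s $ 2 + Q"
    by (simp_all add: c_def nil_geodesic_def P_def Q_def \<sigma>_def \<gamma>_def A_def B_def)
  have c3: "((\<lambda>r. c r t $ 3) has_real_derivative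
      k - x0 s $ 2 * A / 2 + x0 s $ 1 * B / 2 - (B * P + x0 s $ 2 * P' - (A * Q + x0 s $ 1 * Q')) / 2
        - h s * h1 * (sin t - t)) (at s)"
  proof -
    define p q where "p r = h r * (sin (t - \<alpha> r) + sin (\<alpha> r))"
      and "q r = h r * (cos (\<alpha> r) - cos (t - \<alpha> r))" for r
    have [derivative_intros]: "(p has_real_derivative P') (at s)" "(q has_real_derivative Q') (at s)"
      unfolding p_def q_def by (rule Pd Qd)+
    have pq: "p s = P" "q s = Q"
      by (simp_all add: p_def q_def P_def Q_def \<sigma>_def \<gamma>_def A_def B_def)
    show ?thesis
      unfolding c_def nil_geodesic_def vector_add_component vector_3 p_def[symmetric] q_def[symmetric]
      by (auto intro!: derivative_eq_intros simp: pq field_simps)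
  qed
  have "((\<lambda>r. c r t) has_vector_derivative of_frame (c s t)
      (rot (t - \<alpha> s) (vector [b1 t, b2 t, k + h s * h1 * t - h s * b1 t]))) (at s)"
    unfolding has_vector_derivative_vec_iff forall_3 of_frame_nth rot_nth vector_3 a1[unfolded \<sigma>_def \<gamma>_def]
        a2[unfolded \<sigma>_def \<gamma>_def] cs
    by (intro conjI c1 c2, rule DERIV_cong[OF c3], unfold a3) (simp add: field_simps)
  then show ?thesis
    by (simp add: c_def variation_coords_def Let_def b1_def b2_def)
qed

lemma has_vector_derivative_variation_coords:
  assumes [derivative_intros]: "(h has_real_derivative h1 s) (at s)" "(h1 has_real_derivative h2) (at s)"
    "(\<alpha>1 has_real_derivative \<alpha>2) (at s)" "(k has_real_derivative k1) (at s)"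
  defines "\<beta>1 \<equiv> h1 s * \<alpha>1 s + h s * \<alpha>2"
  shows "((\<lambda>r. variation_coords (h r) (h1 r) (\<alpha>1 r) (k r) t) has_vector_derivative
    (let b1 = variation_coords (h s) (h1 s) (\<alpha>1 s) (k s) t $ 1;
         d1 = h2 * sin t - \<beta>1 * (1 - cos t)
     in vector [d1, h2 * cos t - h2 - \<beta>1 * sin t,
       k1 + ((h1 s)\<^sup>2 + h s * h2) * t - (h1 s * b1 + h s * d1)])) (at s)"
  unfolding has_vector_derivative_vec_iff forall_3 variation_coords_def Let_def vector_3 \<beta>1_def
  by (auto intro!: derivative_eq_intros simp: algebra_simps power2_eq_square)

section \<open>The mean curvature in the frame\<close>

lemma normal_of_frame:
  "matrix_inv (gram nil_metric p) *v cross3 (of_frame p a) (of_frame p u) = of_frame p (cross3 a u)"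
  unfolding vec3_eq_iff matrix_inv_gram_nil
  by (simp add: matrix_vector_mult_def sum_3 cross3_nth)
    (simp add: field_simps power2_eq_square)

text \<open>In an orthonormal frame the normal is the Euclidean cross product. Its length and the area element
are nonzero, so only the numerator of the mean curvature matters, and in it the term with
\<open>\<nabla>\<^bsub>X\<^sub>t\<^esub> X\<^sub>t\<close> drops out.\<close>
lemma mean_curvature_zero_frame:
  fixes X :: "real \<Rightarrow> real \<Rightarrow> real ^ 3"
  assumes Xs: "partial_s X s t = of_frame (X s t) a" and Xt: "partial_t X s t = of_frame (X s t) u"
    and indep: "\<And>c d. c *\<^sub>R a + d *\<^sub>R u = 0 \<Longrightarrow> c = 0 \<and> d = 0"
    and ss: "cov_deriv nil_metric (\<lambda>r. X r t) (\<lambda>r. partial_s X r t) s = of_frame (X s t) L"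
    and st: "cov_deriv nil_metric (\<lambda>r. X r t) (\<lambda>r. partial_t X r t) s = of_frame (X s t) M"
    and tt: "cov_deriv nil_metric (\<lambda>r. X s r) (\<lambda>r. partial_t X s r) t = 0"
    and H: "mean_curvature nil_metric X s t = 0"
  shows "(L \<bullet> cross3 a u) * (u \<bullet> u) = 2 * (M \<bullet> cross3 a u) * (a \<bullet> u)"
proof -
  define n where "n = cross3 a u"
  have tt': "cov_deriv nil_metric (\<lambda>r. X s r) (\<lambda>r. partial_t X s r) t = of_frame (X s t) 0"
    unfolding tt by simp
  have N: "unit_normal nil_metric X s t = of_frame (X s t) ((1 / sqrt (n \<bullet> n)) *\<^sub>R n)"
    by (simp add: unit_normal_def Let_def Xs Xt normal_of_frame nil_metric_of_frame n_def
        of_frame_linear)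
  have area: "(a \<bullet> a) * (u \<bullet> u) - (a \<bullet> u)\<^sup>2 = n \<bullet> n"
    unfolding n_def inner_vec3 cross3_nth by algebra
  have "n \<bullet> n \<noteq> 0"
  proof
    assume "n \<bullet> n = 0"
    \<comment> \<open>Up to the factor \<open>u \<bullet> u\<close> this vector is the component of \<open>a\<close> orthogonal to \<open>u\<close>.\<close>
    then have "((u \<bullet> u) *\<^sub>R a + (- (a \<bullet> u)) *\<^sub>R u) \<bullet> ((u \<bullet> u) *\<^sub>R a + (- (a \<bullet> u)) *\<^sub>R u) = 0"
      using area by (simp add: inner_add_left inner_add_right inner_diff_left inner_diff_right
          inner_commute[of u a] power2_eq_square algebra_simps)
    then have *: "(u \<bullet> u) *\<^sub>R a + (- (a \<bullet> u)) *\<^sub>R u = 0"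
      by simp
    then show False
      using indep[OF *] indep[of 0 1] by auto
  qed
  then have "n \<bullet> n > 0"
    by simp
  then show ?thesis
    using H area unfolding mean_curvature_def Let_def N Xs Xt ss st tt' nil_metric_of_frame n_def[symmetric]
    by (simp add: field_simps)
qed

text \<open>The numerator of the mean curvature as an expression in \<open>t\<close>, \<open>S = sin t\<close> and \<open>C = cos t\<close>, up
to a positive factor: \<open>b1, b2, b3\<close> are the coordinates of \<open>X\<^sub>s\<close> in the turned
frame, \<open>d1, d2, d3\<close> their \<open>s\<close>-derivatives, and \<open>l\<close>, \<open>m / 2\<close> the products of \<open>\<nabla>\<^bsub>X\<^sub>s\<^esub> X\<^sub>s\<close>
and \<open>\<nabla>\<^bsub>X\<^sub>s\<^esub> X\<^sub>t\<close> with \<open>X\<^sub>s \<times> X\<^sub>t\<close>. The value type is general so that \<open>t\<close> may also be complex.\<close>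
definition numerator :: "'a \<Rightarrow> 'a \<Rightarrow> 'a \<Rightarrow> 'a \<Rightarrow> 'a \<Rightarrow> 'a \<Rightarrow> 'a \<Rightarrow> 'a \<Rightarrow> 'a \<Rightarrow> 'a \<Rightarrow> 'a :: real_normed_field" where
  "numerator h h1 h2 \<alpha>1 \<alpha>2 k k1 t S C = (let
     \<beta> = h * \<alpha>1; \<beta>1 = h1 * \<alpha>1 + h * \<alpha>2;
     b1 = (1 + h1) * S - \<beta> * (1 - C); b2 = (1 + h1) * C - h1 - \<beta> * S;
     F = k + h * h1 * t; b3 = F - h * b1;
     d1 = h2 * S - \<beta>1 * (1 - C); d2 = h2 * C - h2 - \<beta>1 * S;
     d3 = k1 + (h1\<^sup>2 + h * h2) * t - (h1 * b1 + h * d1);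
     l = b2 * (d1 + \<alpha>1 * b2 + b2 * b3) + (h * b3 - b1) * (d2 - \<alpha>1 * b1 - b1 * b3) - h * b2 * d3;
     m = b2 * (2 * h1 + b2) - (h * b3 - b1) * (2 * \<beta> + b1 + h * b3) + h\<^sup>2 * b2\<^sup>2
   in (1 + h\<^sup>2) * l - F * m)"

text \<open>Here \<open>b\<close> and \<open>w\<close> are \<open>X\<^sub>s\<close> and \<open>X\<^sub>t\<close> in the turned frame, and \<open>L\<close>, \<open>M\<close> are \<open>\<nabla>\<^bsub>X\<^sub>s\<^esub> X\<^sub>s\<close> and
\<open>\<nabla>\<^bsub>X\<^sub>s\<^esub> X\<^sub>t\<close>. The middle summands of \<open>L\<close> and \<open>M\<close> come from the frame turning with angular velocity
\<open>- \<alpha>1\<close> as \<open>s\<close> varies.\<close>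
lemma numerator_zeroI:
  fixes h h1 h2 \<alpha>1 \<alpha>2 k k1 t :: real
  defines "b \<equiv> variation_coords h h1 \<alpha>1 k t" and "w \<equiv> vector [h, 0, 1] :: real ^ 3"
    and "\<beta>1 \<equiv> h1 * \<alpha>1 + h * \<alpha>2"
  defines "b' \<equiv> let d1 = h2 * sin t - \<beta>1 * (1 - cos t)
     in vector [d1, h2 * cos t - h2 - \<beta>1 * sin t, k1 + (h1\<^sup>2 + h * h2) * t - (h1 * b $ 1 + h * d1)]"
  defines "L \<equiv> b' + (- \<alpha>1) *\<^sub>R vector [- (b $ 2), b $ 1, 0] + connection b b"
    and "M \<equiv> vector [h1, 0, 0] + (- \<alpha>1) *\<^sub>R vector [- (w $ 2), w $ 1, 0] + connection b w"
  assumes minimal: "(L \<bullet> cross3 b w) * (w \<bullet> w) = 2 * (M \<bullet> cross3 b w) * (b \<bullet> w)"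
  shows "numerator h h1 h2 \<alpha>1 \<alpha>2 k k1 t (sin t) (cos t) = 0"
proof -
  have b3: "b $ 3 = k + h * h1 * t - h * b $ 1"
    by (simp add: b_def variation_coords_def Let_def)
  define d1 d2 d3 where "d1 = b' $ 1" and "d2 = b' $ 2" and "d3 = b' $ 3"
  have "numerator h h1 h2 \<alpha>1 \<alpha>2 k k1 t (sin t) (cos t) = 
    (1 + h\<^sup>2) * (b $ 2 * (d1 + \<alpha>1 * b $ 2 + b $ 2 * b $ 3)
       + (h * b $ 3 - b $ 1) * (d2 - \<alpha>1 * b $ 1 - b $ 1 * b $ 3) - h * b $ 2 * d3)
    - (k + h * h1 * t) * (b $ 2 * (2 * h1 + b $ 2)
       - (h * b $ 3 - b $ 1) * (2 * (h * \<alpha>1) + b $ 1 + h * b $ 3) + h\<^sup>2 * (b $ 2)\<^sup>2)"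
    by (simp add: numerator_def d1_def d2_def d3_def b'_def b_def variation_coords_def Let_def \<beta>1_def)
  also have "\<dots> = (L \<bullet> cross3 b w) * (w \<bullet> w) - 2 * (M \<bullet> cross3 b w) * (b \<bullet> w)"
  proof -
    have "w \<bullet> w = 1 + h\<^sup>2" "b \<bullet> w = k + h * h1 * t"
      by (simp_all add: w_def inner_vec3 b3 power2_eq_square)
    moreover have "L \<bullet> cross3 b w = b $ 2 * (d1 + \<alpha>1 * b $ 2 + b $ 2 * b $ 3)
       + (h * b $ 3 - b $ 1) * (d2 - \<alpha>1 * b $ 1 - b $ 1 * b $ 3) - h * b $ 2 * d3"
      by (simp add: L_def inner_vec3 cross3_nth w_def d1_def[symmetric] d2_def[symmetric] d3_def[symmetric])
    moreover have "2 * (M \<bullet> cross3 b w) = b $ 2 * (2 * h1 + b $ 2)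
       - (h * b $ 3 - b $ 1) * (2 * (h * \<alpha>1) + b $ 1 + h * b $ 3) + h\<^sup>2 * (b $ 2)\<^sup>2"
      by (simp add: M_def inner_vec3 cross3_nth w_def field_simps power2_eq_square)
    ultimately show ?thesis
      by (simp add: mult.commute)
  qed
  finally show ?thesis
    using minimal by simp
qed

section \<open>Vanishing of the numerator for all times\<close>

lemma numerator_of_real:
  "numerator (of_real h) (of_real h1) (of_real h2) (of_real \<alpha>1) (of_real \<alpha>2) (of_real k) (of_real k1)
     (of_real t) (of_real S) (of_real C) = (of_real (numerator h h1 h2 \<alpha>1 \<alpha>2 k k1 t S C) :: 'a :: real_normed_field)"
  by (simp add: numerator_def Let_def)

text \<open>The expression is entire in \<open>t\<close>, so it vanishes everywhere once it vanishes near \<open>0\<close>. This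
frees the argument from the length of \<open>J\<close>, although the surface need not extend.\<close>
lemma numerator_zero_extends:
  fixes h h1 h2 \<alpha>1 \<alpha>2 k k1 :: real
  assumes J: "open J" "0 \<in> J"
    and zero: "\<And>t. t \<in> J \<Longrightarrow> numerator h h1 h2 \<alpha>1 \<alpha>2 k k1 t (sin t) (cos t) = 0"
  shows "numerator h h1 h2 \<alpha>1 \<alpha>2 k k1 t (sin t) (cos t) = 0"
proof -
  define f :: "complex \<Rightarrow> complex" where "f z = numerator (of_real h) (of_real h1) (of_real h2)
    (of_real \<alpha>1) (of_real \<alpha>2) (of_real k) (of_real k1) z (sin z) (cos z)" for z
  have f_real: "f (of_real t) = of_real (numerator h h1 h2 \<alpha>1 \<alpha>2 k k1 t (sin t) (cos t))" for t
    unfolding f_def sin_of_real cos_of_real by (rule numerator_of_real)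
  have "f holomorphic_on UNIV"
    unfolding f_def numerator_def Let_def by (intro holomorphic_intros)
  moreover have "(0 :: complex) islimpt (of_real ` J)"
  proof -
    have "0 islimpt J"
      using J by (simp add: interior_limit_point interior_open)
    then show ?thesis
      unfolding islimpt_approachable by (force simp: dist_of_real)
  qed
  moreover have "f z = 0" if "z \<in> of_real ` J" for z
    using that zero by (auto simp: f_real)
  ultimately have "f (of_real t) = 0"
    using analytic_continuation[of f UNIV "of_real ` J" 0 "of_real t"] by auto
  then show ?thesis
    by (simp add: f_real)
qed

text \<open>Ordered by powers of \<open>t\<close>, with trigonometric coefficients, the expression has
\<open>h\<^sup>2 (h h1)\<^sup>3\<close> in front of \<open>t\<^sup>3\<close>.\<close>
lemma secular_term_zero:
  fixes h h1 :: real
  assumes zero: "\<And>t. numerator h h1 h2 \<alpha>1 \<alpha>2 k k1 t (sin t) (cos t) = 0"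
  shows "h * h1 = 0"
proof -
  have p: "numerator h h1 h2 \<alpha>1 \<alpha>2 k k1 (2 * pi * of_nat n) 0 1 = 0" for n :: nat
    using zero[of "2 * pi * real n"] sin_2npi[of n] cos_2npi[of n] by (simp add: ac_simps)
  \<comment> \<open>At multiples of \<open>2 \<pi>\<close> the expression is a cubic polynomial in \<open>t\<close>, whose third difference is taken.\<close>
  have "6 * h\<^sup>2 * (h * h1)^3 * (2 * pi)^3 =
      numerator h h1 h2 \<alpha>1 \<alpha>2 k k1 (2 * pi * of_nat 3) 0 1
      - 3 * numerator h h1 h2 \<alpha>1 \<alpha>2 k k1 (2 * pi * of_nat 2) 0 1
      + 3 * numerator h h1 h2 \<alpha>1 \<alpha>2 k k1 (2 * pi * of_nat 1) 0 1
      - numerator h h1 h2 \<alpha>1 \<alpha>2 k k1 (2 * pi * of_nat 0) 0 1"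
    unfolding numerator_def Let_def by (simp add: algebra_simps power2_eq_square power3_eq_cube)
  then show ?thesis
    unfolding p by auto
qed

text \<open>If \<open>h \<noteq> 0\<close>, the terms that grow with \<open>t\<close> force \<open>h1 = h2 = 0\<close>, and a trigonometric
polynomial of degree \<open>3\<close> remains. With \<open>x = b1 + \<beta>\<close> and \<open>y = b2\<close>, the point \<open>(x, y)\<close> runs
through the circle of radius \<open>sqrt (1 + \<beta>\<^sup>2)\<close>, and averaging over the reflection \<open>y \<mapsto> -y\<close>
leaves a cubic polynomial in \<open>x\<close> that vanishes on an interval. Its leading coefficient is
\<open>- (1 + h\<^sup>2) h\<^sup>3\<close>.\<close>
lemma numerator_zero_imp_horizontal_zero:
  fixes h h1 :: real
  assumes zero: "\<And>t. numerator h h1 h2 \<alpha>1 \<alpha>2 k k1 t (sin t) (cos t) = 0"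
  shows "h = 0"
proof (rule ccontr)
  assume h: "h \<noteq> 0"
  then have h1: "h1 = 0"
    using secular_term_zero[OF zero] by simp
  \<comment> \<open>Outside sine and cosine, \<open>t\<close> now occurs only linearly; its coefficient follows from the values at \<open>0\<close> and \<open>2 \<pi>\<close>.\<close>
  have "(1 + h\<^sup>2) * h\<^sup>2 * h2 * (2 * pi) = 0"
    using zero[of 0] zero[of "2 * pi"]
    by (simp add: numerator_def Let_def h1 algebra_simps power2_eq_square)
  then have h2: "h2 = 0"
    using h by (auto simp: add_nonneg_eq_0_iff)
  define \<beta> c where "\<beta> = h * \<alpha>1" and "c = 1 / (1 + \<beta>\<^sup>2)"
  have R: "1 + \<beta>\<^sup>2 > 0"
    by (smt (verit) zero_le_power2)
  then have c: "c * (1 + \<beta>\<^sup>2) = 1"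
    by (simp add: c_def)
  \<comment> \<open>The part that is even in \<open>y\<close>, with \<open>y\<^sup>2\<close> replaced by \<open>1 + \<beta>\<^sup>2 - x\<^sup>2\<close>.\<close>
  define A where "A x = (1 + h\<^sup>2) * (h * \<alpha>2 * c * (1 + h\<^sup>2) * (1 + \<beta>\<^sup>2 - x\<^sup>2)
      + (\<alpha>1 + k + h * \<beta> - h * x) * (1 + \<beta>\<^sup>2 - x\<^sup>2)
      + (h * k + (1 + h\<^sup>2) * (\<beta> - x)) * (- (h * \<alpha>2 * c * x) - (\<alpha>1 + k + h * \<beta> - h * x) * (x - \<beta>)))
      - k * ((1 + h\<^sup>2) * (1 + \<beta>\<^sup>2 - x\<^sup>2)
      - (h * k + (1 + h\<^sup>2) * (\<beta> - x)) * (\<beta> + x + h * (k + h * \<beta> - h * x)))" for x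
  \<comment> \<open>The arguments solve \<open>x = S + \<beta> C\<close>, \<open>y = C - \<beta> S\<close> for sine and cosine.\<close>
  have on_circle: "numerator h 0 0 \<alpha>1 \<alpha>2 k k1 0 (c * (x - \<beta> * y)) (c * (\<beta> * x + y)) = 0"
    if "x\<^sup>2 + y\<^sup>2 = 1 + \<beta>\<^sup>2" for x y
  proof -
    have "(c * (\<beta> * x + y))\<^sup>2 + (c * (x - \<beta> * y))\<^sup>2 = 1"
      using that c by algebra
    then obtain t where "c * (\<beta> * x + y) = cos t" "c * (x - \<beta> * y) = sin t"
      using sincos_total_2pi by metis
    then show ?thesis
      using zero[of t] by (simp add: h1 h2 numerator_def Let_def)
  qed
  have A: "A x = 0" if "x\<^sup>2 \<le> 1" for x
  proof -
    define y where "y = sqrt (1 + \<beta>\<^sup>2 - x\<^sup>2)"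
    have y: "y\<^sup>2 = 1 + \<beta>\<^sup>2 - x\<^sup>2"
      using that unfolding y_def by (subst real_sqrt_pow2) (auto intro: add_increasing2)
    have coords: "c * (x - \<beta> * y) - \<beta> * (1 - c * (\<beta> * x + y)) = x - \<beta>"
      "c * (\<beta> * x + y) - \<beta> * (c * (x - \<beta> * y)) = y" for y
      using c by algebra+
    have "2 * A x = numerator h 0 0 \<alpha>1 \<alpha>2 k k1 0 (c * (x - \<beta> * y)) (c * (\<beta> * x + y))
        + numerator h 0 0 \<alpha>1 \<alpha>2 k k1 0 (c * (x - \<beta> * -y)) (c * (\<beta> * x + -y))"
      unfolding numerator_def Let_def \<beta>_def[symmetric] add_0_right mult_1 mult_zero_left diff_zero coords
        A_def mult_zero_right add_0_left y[symmetric]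
      by (simp add: algebra_simps power2_eq_square)
    also have "\<dots> = 0"
      using on_circle[of x y] on_circle[of x "-y"] y by simp
    finally show ?thesis
      by simp
  qed
  \<comment> \<open>This combination of values isolates the leading coefficient of a cubic polynomial.\<close>
  have "A 1 - A (-1) - 2 * A (1/2) + 2 * A (-1/2) = - (3/2) * (1 + h\<^sup>2) * h ^ 3"
    unfolding A_def by (simp add: field_simps power2_eq_square power3_eq_cube)
  then show False
    using A[of 1] A[of "-1"] A[of "1/2"] A[of "-1/2"] h
    by (auto simp: power2_eq_square add_nonneg_eq_0_iff)
qed

section \<open>Minimal surfaces ruled by geodesics\<close>

theorem lemma2p1:
  fixes I J :: "real set" and h \<alpha> k :: "real \<Rightarrow> real"
    and X :: "real \<Rightarrow> real \<Rightarrow> real ^ 3"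
  assumes "open I" and "is_interval I"
    and "open J" and "is_interval J" and "0 \<in> J"
    and "smooth_on I h" and "smooth_on I \<alpha>" and "smooth_on I k"
    and "regular_surface I J X"
    and "\<And>s. s \<in> I \<Longrightarrow> partial_s X s 0 =
           sin (\<alpha> s) *\<^sub>R nil_e1 (X s 0) + cos (\<alpha> s) *\<^sub>R nil_e2 (X s 0) + k s *\<^sub>R nil_e3 (X s 0)"
    and "\<And>s. s \<in> I \<Longrightarrow> partial_t X s 0 =
           h s *\<^sub>R (cos (\<alpha> s) *\<^sub>R nil_e1 (X s 0) - sin (\<alpha> s) *\<^sub>R nil_e2 (X s 0)) + nil_e3 (X s 0)"
    and "\<And>s t. s \<in> I \<Longrightarrow> t \<in> J \<Longrightarrow> cov_deriv nil_metric (X s) (partial_t X s) t = 0"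
    and "minimal_surface nil_metric I J X"
  shows "\<forall>s\<in>I. h s = 0"
proof
  fix s assume s: "s \<in> I"
  have smooth: "smooth_on (I \<times> J) (\<lambda>(s, t). X s t)"
    using assms(9) by (simp add: regular_surface_def)
  note dX = smooth_surface_derivatives[OF smooth assms(1,3)]
  have Xs0: "partial_s X r 0 = of_frame (X r 0) (vector [sin (\<alpha> r), cos (\<alpha> r), k r])" if "r \<in> I" for r
    using assms(10)[OF that] by (simp add: of_frame_def)
  have Xt0: "partial_t X r 0 = of_frame (X r 0) (vector [h r * cos (\<alpha> r), - (h r * sin (\<alpha> r)), 1])"
    if "r \<in> I" for r
    using assms(11)[OF that] by (simp add: of_frame_def scaleR_diff_right)
  \<comment> \<open>In the turned frame the velocity is the same along each geodesic.\<close>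
  have geodesic: "partial_t X r t = of_frame (X r t) (rot (t - \<alpha> r) (vector [h r, 0, 1]))"
      "X r t = nil_geodesic (X r 0) (h r) (\<alpha> r) t" if r: "r \<in> I" and t: "t \<in> J" for r t
  proof -
    define u where "u t = frame_coords (X r t) (partial_t X r t)" for t
    have Xt: "partial_t X r t = of_frame (X r t) (u t)" for t
      by (simp add: u_def of_frame_coords)
    have "\<exists>w. (u has_vector_derivative w) (at t)" if "t \<in> J" for t
      using frame_coords_has_vector_derivative[OF dX(2)[OF r that]] dX(3)[OF r that]
      unfolding u_def by blast
    then obtain u' where u': "(u has_vector_derivative u' t) (at t)" if "t \<in> J" for t
      by metis
    have dc: "(X r has_vector_derivative of_frame (X r t) (u t)) (at t)" if "t \<in> J" for t
      using dX(2)[OF r that] Xt by simp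
    have geo: "u' t + connection (u t) (u t) = 0" if "t \<in> J" for t
      using cov_deriv_of_frame[OF dc[OF that] u'[OF that] assms(3) that, of "partial_t X r"]
        assms(12)[OF r that] by (simp add: Xt)
    have u0: "u 0 = vector [h r * cos (\<alpha> r), - (h r * sin (\<alpha> r)), 1]"
      using Xt0[OF r] Xt[of 0] by simp
    note explicit = nil_geodesic_explicit[OF assms(4,5) dc u' geo u0 t]
    show "X r t = nil_geodesic (X r 0) (h r) (\<alpha> r) t"
      using explicit(2) .
    show "partial_t X r t = of_frame (X r t) (rot (t - \<alpha> r) (vector [h r, 0, 1]))"
    proof -
      have "u t = rot (t - \<alpha> r) (vector [h r, 0, 1])"
        using explicit(1) by (simp add: vec3_eq_iff mult.commute)
      then show ?thesis
        by (simp add: Xt)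
    qed
  qed
  obtain h1 where h1: "smooth_on I h1" "\<And>r. r \<in> I \<Longrightarrow> (h has_real_derivative h1 r) (at r)"
    using smooth_on_real_derivative[OF assms(6,1)] by blast
  obtain h2 where h2: "\<And>r. r \<in> I \<Longrightarrow> (h1 has_real_derivative h2 r) (at r)"
    using smooth_on_real_derivative[OF h1(1) assms(1)] by blast
  obtain \<alpha>1 where \<alpha>1: "smooth_on I \<alpha>1" "\<And>r. r \<in> I \<Longrightarrow> (\<alpha> has_real_derivative \<alpha>1 r) (at r)"
    using smooth_on_real_derivative[OF assms(7,1)] by blast
  obtain \<alpha>2 where \<alpha>2: "\<And>r. r \<in> I \<Longrightarrow> (\<alpha>1 has_real_derivative \<alpha>2 r) (at r)"
    using smooth_on_real_derivative[OF \<alpha>1(1) assms(1)] by blast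
  obtain k1 where k1: "\<And>r. r \<in> I \<Longrightarrow> (k has_real_derivative k1 r) (at r)"
    using smooth_on_real_derivative[OF assms(8,1)] by blast
  define b where "b r t = variation_coords (h r) (h1 r) (\<alpha>1 r) (k r) t" for r t
  define w :: "real \<Rightarrow> real ^ 3" where "w r = vector [h r, 0, 1]" for r
  have Xs: "((\<lambda>r. X r t) has_vector_derivative of_frame (X r t) (rot (t - \<alpha> r) (b r t))) (at r)"
    if r: "r \<in> I" and t: "t \<in> J" for r t
  proof -
    have "((\<lambda>r. X r 0) has_vector_derivative of_frame (X r 0) (vector [sin (\<alpha> r), cos (\<alpha> r), k r])) (at r)"
      using dX(1)[OF r assms(5)] Xs0[OF r] by simp
    from nil_geodesic_variation[OF this h1(2)[OF r] \<alpha>1(2)[OF r], of t]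
    have "((\<lambda>r. nil_geodesic (X r 0) (h r) (\<alpha> r) t) has_vector_derivative
        of_frame (X r t) (rot (t - \<alpha> r) (b r t))) (at r)"
      by (simp add: b_def geodesic(2)[OF r t])
    then show ?thesis
      by (rule has_vector_derivative_transform_within_open[OF _ assms(1) r]) (simp add: geodesic(2)[OF _ t])
  qed
  have partial_s: "partial_s X r t = of_frame (X r t) (rot (t - \<alpha> r) (b r t))" if "r \<in> I" "t \<in> J" for r t
    unfolding partial_s_def using vector_derivative_at[OF Xs[OF that]] .
  have "numerator (h s) (h1 s) (h2 s) (\<alpha>1 s) (\<alpha>2 s) (k s) (k1 s) t (sin t) (cos t) = 0" if t: "t \<in> J" for t
  proof (rule numerator_zeroI, fold w_def b_def)
    note db = has_vector_derivative_variation_coords[OF h1(2)[OF s] h2[OF s] \<alpha>2[OF s] k1[OF s], of t, folded b_def]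
    have d\<theta>: "((\<lambda>r. t - \<alpha> r) has_real_derivative - \<alpha>1 s) (at s)"
      by (auto intro!: derivative_eq_intros \<alpha>1(2) s)
    have dw: "(w has_vector_derivative vector [h1 s, 0, 0]) (at s)"
      unfolding has_vector_derivative_vec_iff forall_3 w_def vector_3 by (simp add: h1(2) s)
    note ss = cov_deriv_of_frame[OF Xs[OF s t] has_vector_derivative_rot[OF db d\<theta>] assms(1) s,
        of "\<lambda>r. partial_s X r t", OF partial_s[OF _ t], unfolded rot_connection, folded rot_add]
    note st = cov_deriv_of_frame[OF Xs[OF s t] has_vector_derivative_rot[OF dw d\<theta>] assms(1) s,
        of "\<lambda>r. partial_t X r t", OF geodesic(1)[OF _ t, folded w_def], unfolded rot_connection, folded rot_add]
    have indep: "c = 0 \<and> d = 0"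
      if "c *\<^sub>R rot (t - \<alpha> s) (b s t) + d *\<^sub>R rot (t - \<alpha> s) (w s) = 0" for c d
    proof -
      have "c *\<^sub>R partial_s X s t + d *\<^sub>R partial_t X s t = 0"
        unfolding partial_s[OF s t] geodesic(1)[OF s t, folded w_def] of_frame_linear[symmetric] that
        by simp
      then show ?thesis
        using assms(9) s t by (simp add: regular_surface_def)
    qed
    have "mean_curvature nil_metric X s t = 0"
      using assms(13) s t by (simp add: minimal_surface_def)
    from mean_curvature_zero_frame[OF partial_s[OF s t] geodesic(1)[OF s t, folded w_def] indep ss st _ this]
    show "((let d1 = h2 s * sin t - (h1 s * \<alpha>1 s + h s * \<alpha>2 s) * (1 - cos t)
       in vector [d1, h2 s * cos t - h2 s - (h1 s * \<alpha>1 s + h s * \<alpha>2 s) * sin t,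
           k1 s + ((h1 s)\<^sup>2 + h s * h2 s) * t - (h1 s * b s t $ 1 + h s * d1)])
         + (- \<alpha>1 s) *\<^sub>R vector [- (b s t $ 2), b s t $ 1, 0] + connection (b s t) (b s t))
        \<bullet> cross3 (b s t) (w s) * (w s \<bullet> w s) =
      2 * ((vector [h1 s, 0, 0] + (- \<alpha>1 s) *\<^sub>R vector [- (w s $ 2), w s $ 1, 0] + connection (b s t) (w s))
        \<bullet> cross3 (b s t) (w s)) * (b s t \<bullet> w s)"
      using assms(12)[OF s t] unfolding rot_cross3 rot_inner by simp
  qed
  then show "h s = 0"
    using numerator_zero_imp_horizontal_zero[OF numerator_zero_extends[OF assms(3,5)]] by blast
qed

end
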